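(* Let $\mathcal B\subseteq\mathcal E$ be such that $\mathrm{cone}(\mathcal B)$ is a maximal elementary simplicial cone (MESC) for $p$-boxes on $\mathcal X=\{x_1<\cdots<x_n\}$. Let $\mathcal A=\{A_{i_1},\dots,A_{i_k}\}$, $i_1<\dots<i_k$, be the associated chain and $B_1,\dots,B_k$ the associated members of $\mathcal B$. Let $1\le j\le k-1$, put $A=A_{i_j}$ and $A'=A_{i_{j+1}}$, let $m=|A'\setminus A|$, and denote by $y_1<\dots<y_m$ the elements of $A'\setminus A$. Let $\mathcal S$ be the collection of singleton generators $\{y\}\in\mathcal B$ with $y\in A'\setminus A$. Then: 1. If $B_j=A$ and $B_{j+1}=A'$, then $\mathcal S=\{\{y_2\},\dots,\{y_m\}\}$. 2. If $B_j=A$ and $B_{j+1}=A'^c$, then $m=1$ (and $\mathcal S=\emptyset$). 3. If $B_j=A^c$ and $B_{j+1}=A'$, then $\mathcal S$ consists of exactly $m-1$ of the $m$ singletons $\{y_1\},\dots,\{y_m\}$. 4. If $B_j=A^c$ and $B_{j+1}=A'^c$, then $\mathcal S=\{\{y_1\},\dots,\{y_{m-1}\}\}$.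
   Context: Let $\mathcal X=\{x_1,\dots,x_n\}\subset\mathbb R$ with $x_1<\cdots<x_n$, let $A_i=\{x_1,\dots,x_i\}$ for $i=1,\dots,n$ (so $A_n=\mathcal X$), and let $A^c=\mathcal X\setminus A$. Real functions on $\mathcal X$ are identified with vectors in $\mathbb R^n$, and $\mathbb I_A$ is the indicator function of $A\subseteq\mathcal X$. The family of generator sets for $p$-boxes is $\mathcal E=\{A_i\colon 1\le i\le n\}\cup\{A_i^c\colon 1\le i\le n-1\}\cup\{\{x_i\}\colon 1\le i\le n\}$. For $\mathcal B\subseteq\mathcal E$ define $\mathrm{cone}(\mathcal B)=\{\sum_{B\in\mathcal B\setminus\{\mathcal X\}}\alpha_B\mathbb I_B+\alpha\,\mathbb I_{\mathcal X}\colon \alpha_B\ge 0,\ \alpha\in\mathbb R\}$, i.e. the constant function may appear with an arbitrary real coefficient. The cone $\mathrm{cone}(\mathcal B)$ is a maximal elementary simplicial cone (MESC) if $\{\mathbb I_B\colon B\in\mathcal B\}$ is a basis of $\mathbb R^n$ (so $|\mathcal B|=n$) and $\mathbb I_C\notin\mathrm{cone}(\mathcal B)$ for every $C\in\mathcal E\setminus\mathcal B$. If $\mathrm{cone}(\mathcal B)$ is a MESC, then $A_n\in\mathcal B$ and for each $i$ at most one of $A_i$, $A_i^c$ is in $\mathcal B$. The associated chain $\mathcal A=\{A_{i_1},\dots,A_{i_k}\}$ ($i_1<\dots<i_k=n$) consists of all $A_i$ such that $A_i\in\mathcal B$ or $A_i^c\in\mathcal B$; set $B_j=A_{i_j}$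 if $A_{i_j}\in\mathcal B$ and $B_j=A_{i_j}^c$ if $A_{i_j}^c\in\mathcal B$. The singleton generators of $\mathcal B$ are the remaining members of $\mathcal B$, i.e. the elements of $\mathcal B\setminus\{B_1,\dots,B_k\}$, all of which are singletons; in particular $\{x_1\}=A_1$ and $\{x_n\}=A_{n-1}^c$, when in $\mathcal B$, are counted among the $B_j$ and not among the singleton generators. *)

theory Defs
  imports "HOL-Analysis.Analysis" "HOL-Library.Function_Algebras"
begin

(* Pointwise scalar multiplication makes real-valued functions a real vector space, so that
   independent, span and sums below are the library notions. *)

instantiation "fun" :: (type, real_vector) real_vector
begin

definition scaleR_fun_def: "r *\<^sub>R f = (\<lambda>t. r *\<^sub>R f t)"

instance
  by standard (simp_all add: scaleR_fun_def fun_eq_iff scaleR_add_right scaleR_add_left)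

end

(* The points are x 1 < ... < x n; the value of x outside {1..n} is irrelevant. *)

definition ground :: "(nat \<Rightarrow> real) \<Rightarrow> nat \<Rightarrow> real set" where
  "ground x n = x ` {1..n}"

definition lower_set :: "(nat \<Rightarrow> real) \<Rightarrow> nat \<Rightarrow> real set" where
  "lower_set x i = x ` {1..i}"

definition generators :: "(nat \<Rightarrow> real) \<Rightarrow> nat \<Rightarrow> real set set" where
  "generators x n =
     {lower_set x i | i. 1 \<le> i \<and> i \<le> n}
     \<union> {ground x n - lower_set x i | i. 1 \<le> i \<and> i \<le> n - 1}
     \<union> {{x i} | i. 1 \<le> i \<and> i \<le> n}"

(* A real function on X is represented by its extension by zero to all reals; for a subset A
   of X this turns the indicator function on X into the library's indicat_real A. *)

definition functions_on :: "real set \<Rightarrow> (real \<Rightarrow> real) set" where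
  "functions_on X = {f. \<forall>t. t \<notin> X \<longrightarrow> f t = 0}"

definition gen_cone :: "real set \<Rightarrow> real set set \<Rightarrow> (real \<Rightarrow> real) set" where
  "gen_cone X \<B> =
     {(\<Sum>B\<in>\<B> - {X}. \<alpha> B *\<^sub>R indicat_real B) + c *\<^sub>R indicat_real X | \<alpha> c.
        \<forall>B\<in>\<B> - {X}. 0 \<le> \<alpha> B}"

(* The family of indicators is injective in its index, so its being a basis is the same as its
   range being one. *)

definition is_MESC :: "(nat \<Rightarrow> real) \<Rightarrow> nat \<Rightarrow> real set set \<Rightarrow> bool" where
  "is_MESC x n \<B> \<longleftrightarrow>
     independent (indicat_real ` \<B>)
     \<and> span (indicat_real ` \<B>) = functions_on (ground x n)
     \<and> (\<forall>C\<in>generators x n - \<B>. indicat_real C \<notin> gen_cone (ground x n) \<B>)"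

(* The chain is recorded by its indices i rather than by the sets A_i; i determines A_i and
   conversely. *)

definition chain_indices :: "(nat \<Rightarrow> real) \<Rightarrow> nat \<Rightarrow> real set set \<Rightarrow> nat set" where
  "chain_indices x n \<B> =
     {i\<in>{1..n}. lower_set x i \<in> \<B> \<or> ground x n - lower_set x i \<in> \<B>}"

(* For an MESC at most one of the two candidate sets is in the family, so the order of the
   tests does not matter. *)

definition chain_member ::
  "(nat \<Rightarrow> real) \<Rightarrow> nat \<Rightarrow> real set set \<Rightarrow> nat \<Rightarrow> real set" where
  "chain_member x n \<B> i =
     (if lower_set x i \<in> \<B> then lower_set x i else ground x n - lower_set x i)"

definition singleton_generators ::
  "(nat \<Rightarrow> real) \<Rightarrow> nat \<Rightarrow> real set set \<Rightarrow> real set set" where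
  "singleton_generators x n \<B> = \<B> - chain_member x n \<B> ` chain_indices x n \<B>"

end

(* Cut X into the blocks A' - A between consecutive chain sets A, A'.  Every chain member is a
   union of blocks, so its indicator is constant on each of them.  If two singletons of a block
   were missing from the basis, its span could not separate these two points; if none were
   missing, the indicator of the block would be both a combination of chain members and the sum
   of its singletons, which contradicts independence.  Hence exactly one singleton is missing.
   Maximality locates it: if A and {y_1} are generators and m > 1, then A together with y_1 is
   the next lower set, which lies in the cone but not in the family; dually for the complement
   of A' and {y_m}. *)
theory Submission
  imports Defs
begin

section \<open>Indicator functions: sums, separation of points, membership in the cone\<close>

lemma inj_indicat_real: "inj (indicat_real :: 'a set \<Rightarrow> 'a \<Rightarrow> real)"
proof (rule injI)
  fix A B :: "'a set"
  assume "indicat_real A = indicat_real B"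
  then have "t \<in> A \<longleftrightarrow> t \<in> B" for t
    by (metis indicator_eq_1_iff)
  then show "A = B" by blast
qed

lemma indicat_real_Un_disjoint:
  "A \<inter> B = {} \<Longrightarrow> indicat_real (A \<union> B) = indicat_real A + indicat_real B"
  by (auto simp: fun_eq_iff indicator_def)

lemma indicat_real_eq_sum_singletons:
  assumes "finite D"
  shows "indicat_real D = (\<Sum>t\<in>D. indicat_real {t})"
  using assms
proof (induction D)
  case empty
  then show ?case by (simp add: fun_eq_iff)
next
  case (insert t D)
  then show ?case
    using indicat_real_Un_disjoint[of "{t}" D] by simp
qed

text \<open>If no member of \<B> separated \<open>p\<close> from \<open>q\<close>, all indicators,
  and hence their span, would lie in the subspace of functions with equal values at \<open>p\<close>
  and \<open>q\<close>. The indicator of \<open>{p}\<close> is a function on \<open>X\<close>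
  outside that subspace.\<close>

lemma separated_by_spanning_indicators:
  assumes span: "functions_on X \<subseteq> span (indicat_real ` \<B>)"
    and "p \<in> X" "p \<noteq> q"
  obtains C where "C \<in> \<B>" "p \<in> C \<longleftrightarrow> q \<notin> C"
proof -
  have "\<exists>C\<in>\<B>. p \<in> C \<longleftrightarrow> q \<notin> C"
  proof (rule ccontr)
    assume not_separated: "\<not> ?thesis"
    have "indicat_real C p = indicat_real C q" if "C \<in> \<B>" for C
      using not_separated that by (cases "p \<in> C"; cases "q \<in> C") auto
    then have "indicat_real ` \<B> \<subseteq> {f. f p = f q}"
      by blast
    moreover have "subspace {f :: real \<Rightarrow> real. f p = f q}"
      by (auto simp: subspace_def scaleR_fun_def)
    ultimately have "span (indicat_real ` \<B>) \<subseteq> {f. f p = f q}"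
      by (rule span_minimal)
    moreover have "indicat_real {p} \<in> functions_on X"
      using \<open>p \<in> X\<close> by (auto simp: functions_on_def indicator_def)
    ultimately have "indicat_real {p} p = indicat_real {p} q"
      using span by blast
    with \<open>p \<noteq> q\<close> show False by simp
  qed
  then show ?thesis using that by (elim bexE)
qed

text \<open>Coefficient 1 on \<open>B\<close> and \<open>C\<close> and 0 on the other members gives
  the indicator of the union, by disjointness. As both sets differ from \<open>X\<close>, they are
  indices of the sum with nonnegative coefficients.\<close>

lemma indicat_in_gen_cone_Un:
  assumes "finite \<B>" "B \<in> \<B>" "C \<in> \<B>" "B \<noteq> X" "C \<noteq> X" "B \<noteq> C" "B \<inter> C = {}"
  shows "indicat_real (B \<union> C) \<in> gen_cone X \<B>"
proof -
  let ?\<alpha> = "indicat_real {B, C}"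
  have "(\<Sum>D\<in>\<B> - {X}. ?\<alpha> D *\<^sub>R indicat_real D) = (\<Sum>D\<in>{B, C}. ?\<alpha> D *\<^sub>R indicat_real D)"
    using assms by (intro sum.mono_neutral_right) auto
  also have "\<dots> = indicat_real (B \<union> C)"
    using assms by (simp add: indicat_real_Un_disjoint)
  finally show ?thesis
    unfolding gen_cone_def
    by (intro CollectI exI[of _ ?\<alpha>] exI[of _ 0]) simp
qed

section \<open>Consequences of the basis property and of maximality\<close>

locale MESC =
  fixes x :: "nat \<Rightarrow> real" and n :: nat and \<B> :: "real set set"
  assumes x_mono: "strict_mono_on {1..n} x"
    and generators: "\<B> \<subseteq> generators x n"
    and MESC: "is_MESC x n \<B>"
begin

lemma finite_family: "finite \<B>"
proof -
  have "generators x n \<subseteq> Pow (ground x n)"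
    by (auto simp: generators_def ground_def lower_set_def)
  moreover have "finite (ground x n)" by (simp add: ground_def)
  ultimately show ?thesis
    using generators by (meson finite_Pow_iff finite_subset)
qed

lemma inj: "inj_on x {1..n}"
  using x_mono by (rule strict_mono_on_imp_inj_on)

text \<open>The constant function lies in every cone, with coefficient 1 on the whole set, so
  maximality forces this generator into the family.\<close>

lemma ground_in_family:
  assumes "1 \<le> n"
  shows "ground x n \<in> \<B>"
proof (rule ccontr)
  assume "ground x n \<notin> \<B>"
  moreover have "ground x n \<in> generators x n"
    unfolding generators_def ground_def lower_set_def using assms by blast
  moreover have "indicat_real (ground x n) \<in> gen_cone (ground x n) \<B>"
    unfolding gen_cone_def by (intro CollectI exI[of _ "\<lambda>_. 0"] exI[of _ 1]) simp
  ultimately show False using MESC unfolding is_MESC_def by blast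
qed

lemma lower_set_subset_ground: "l \<le> n \<Longrightarrow> lower_set x l \<subseteq> ground x n"
  by (auto simp: lower_set_def ground_def)

lemma mem_lower_set: "p \<in> {1..n} \<Longrightarrow> l \<le> n \<Longrightarrow> x p \<in> lower_set x l \<longleftrightarrow> p \<le> l"
  unfolding lower_set_def by (subst inj_on_image_mem_iff[OF inj]) auto

lemma chain_member_in_family: "l \<in> chain_indices x n \<B> \<Longrightarrow> chain_member x n \<B> l \<in> \<B>"
  by (auto simp: chain_indices_def chain_member_def)

lemma chain_member_eq_lower_setD:
  assumes "l \<in> chain_indices x n \<B>" "chain_member x n \<B> l = lower_set x l"
  shows "lower_set x l \<in> \<B>"
  using assms chain_member_in_family by metis

text \<open>The bound \<open>l < n\<close> holds because \<open>chain_member\<close> tests the lower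
  set first, and at index \<open>n\<close> that set is the whole ground set, which belongs to \<B>.
  The complement form therefore cannot occur there.\<close>

lemma chain_member_eq_complementD:
  assumes "l \<in> chain_indices x n \<B>" "chain_member x n \<B> l = ground x n - lower_set x l"
  shows "ground x n - lower_set x l \<in> \<B>" and "l < n"
proof -
  show *: "ground x n - lower_set x l \<in> \<B>"
    using assms chain_member_in_family by metis
  have l: "1 \<le> l" "l \<le> n" using assms by (auto simp: chain_indices_def)
  have "l \<noteq> n"
  proof
    assume "l = n"
    then have "lower_set x l \<in> \<B>"
      using ground_in_family l by (simp add: ground_def lower_set_def)
    then have "lower_set x l = ground x n - lower_set x l"
      using assms(2) by (simp add: chain_member_def)
    moreover have "x 1 \<in> lower_set x l" using l by (auto simp: lower_set_def)
    ultimately show False by blast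
  qed
  with l show "l < n" by simp
qed

text \<open>Removing \<open>t\<close> leaves every chain member in place, among them the ground set,
  which is the member at index \<open>n\<close>. A lower set represented by its complement is
  recovered as a difference from the ground set. With \<open>t\<close> a singleton generator this
  feeds the contradiction to independence.\<close>

lemma lower_set_in_span:
  assumes "l \<in> chain_indices x n \<B>" "t \<notin> chain_member x n \<B> ` chain_indices x n \<B>"
  shows "indicat_real (lower_set x l) \<in> span (indicat_real ` (\<B> - {t}))"
proof -
  let ?F = "indicat_real ` (\<B> - {t})"
  have l: "1 \<le> l" "l \<le> n" using assms(1) by (auto simp: chain_indices_def)
  have X: "ground x n \<in> \<B>" using ground_in_family l by simp
  then have "n \<in> chain_indices x n \<B>" "chain_member x n \<B> n = ground x n"
    using l by (auto simp: chain_indices_def chain_member_def ground_def lower_set_def)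
  then have "ground x n \<noteq> t" using assms(2) by (metis imageI)
  then have XF: "indicat_real (ground x n) \<in> span ?F"
    using X by (intro span_base) auto
  have CF: "indicat_real (chain_member x n \<B> l) \<in> span ?F"
    using chain_member_in_family[OF assms(1)] assms by (intro span_base) auto
  show ?thesis
  proof (cases "lower_set x l \<in> \<B>")
    case True
    then show ?thesis using CF by (simp add: chain_member_def)
  next
    case False
    have "lower_set x l \<union> (ground x n - lower_set x l) = ground x n"
      using lower_set_subset_ground l by blast
    then have "indicat_real (ground x n)
        = indicat_real (lower_set x l) + indicat_real (ground x n - lower_set x l)"
      using indicat_real_Un_disjoint[of "lower_set x l" "ground x n - lower_set x l"] by auto
    then have "indicat_real (lower_set x l)
        = indicat_real (ground x n) - indicat_real (chain_member x n \<B> l)"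
      using False by (simp add: chain_member_def)
    then show ?thesis using span_diff[OF XF CF] by simp
  qed
qed

text \<open>Maximality as a closure property: the indicator of the union lies in the cone, and a
  generator with indicator in the cone must be a member.\<close>

lemma Un_generator_in_family:
  assumes "B \<in> \<B>" "C \<in> \<B>" "B \<noteq> ground x n" "C \<noteq> ground x n" "B \<noteq> C" "B \<inter> C = {}"
    and "B \<union> C \<in> generators x n"
  shows "B \<union> C \<in> \<B>"
  using indicat_in_gen_cone_Un[OF finite_family assms(1-6)] assms(7) MESC
  unfolding is_MESC_def by blast

end

section \<open>Blocks between consecutive chain sets and their missing singleton\<close>

locale MESC_block = MESC +
  fixes i i' :: nat
  assumes i: "i \<in> chain_indices x n \<B>"
    and i': "i' \<in> chain_indices x n \<B>"
    and less: "i < i'"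
    and consecutive: "\<And>l. i < l \<Longrightarrow> l < i' \<Longrightarrow> l \<notin> chain_indices x n \<B>"
begin

definition block :: "real set" where
  "block = lower_set x i' - lower_set x i"

lemma bounds: "1 \<le> i" "i' \<le> n"
  using i i' by (auto simp: chain_indices_def)

lemma block_eq: "block = x ` {i + 1..i'}"
proof -
  have "{1..i'} - {1..i} = {i + 1..i'}" using bounds by auto
  moreover have "x ` {1..i'} - x ` {1..i} = x ` ({1..i'} - {1..i})"
    using bounds less by (intro inj_on_image_set_diff[OF inj, symmetric]) auto
  ultimately show ?thesis by (simp add: block_def lower_set_def)
qed

lemma finite_block: "finite block"
  by (simp add: block_eq)

text \<open>A chain index is at most \<open>i\<close> or at least \<open>i'\<close>: its lower set
  misses the block in the first case and contains it in the second.\<close>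

lemma chain_constant_on_block:
  assumes "l \<in> chain_indices x n \<B>" "p \<in> block" "q \<in> block"
  shows "p \<in> lower_set x l \<longleftrightarrow> q \<in> lower_set x l"
proof -
  obtain a b where "p = x a" "q = x b" "a \<in> {i + 1..i'}" "b \<in> {i + 1..i'}"
    using assms by (auto simp: block_eq)
  moreover have "l \<le> i \<or> i' \<le> l" using assms(1) consecutive[of l] by linarith
  moreover have "l \<le> n" using assms(1) by (simp add: chain_indices_def)
  ultimately show ?thesis
    using mem_lower_set[of a l] mem_lower_set[of b l] bounds by auto
qed

text \<open>Some member \<open>C\<close> has to separate \<open>p\<close> from \<open>q\<close>.
  Chain sets and their complements cannot do so, and a singleton that does is \<open>{p}\<close> or
  \<open>{q}\<close>.\<close>

lemma missing_singleton_unique: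
  assumes p: "p \<in> block" "{p} \<notin> singleton_generators x n \<B>"
    and q: "q \<in> block" "{q} \<notin> singleton_generators x n \<B>"
  shows "p = q"
proof (rule ccontr)
  assume "p \<noteq> q"
  have sub: "block \<subseteq> ground x n"
    using lower_set_subset_ground[OF bounds(2)] by (auto simp: block_def)
  have "functions_on (ground x n) \<subseteq> span (indicat_real ` \<B>)"
    using MESC by (simp add: is_MESC_def)
  then obtain C where C: "C \<in> \<B>" "p \<in> C \<longleftrightarrow> q \<notin> C"
    using separated_by_spanning_indicators \<open>p \<noteq> q\<close> p(1) sub by blast
  have chain: "\<exists>l\<in>chain_indices x n \<B>. C = lower_set x l \<or> C = ground x n - lower_set x l"
  proof (cases "C \<in> singleton_generators x n \<B>")
    case True
    \<comment> \<open>By its definition \<open>singleton_generators\<close> is only a set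
      difference, so \<open>C\<close> is not yet known to be a singleton. If it is a lower set or a
      complement, its index is still a chain index, which suffices.\<close>
    consider (lower) l where "1 \<le> l" "l \<le> n" "C = lower_set x l"
      | (complement) l where "1 \<le> l" "l \<le> n - 1" "C = ground x n - lower_set x l"
      | (singleton) l where "C = {x l}"
      using C(1) generators unfolding generators_def by blast
    then show ?thesis
    proof cases
      case lower
      then show ?thesis using C(1) by (auto simp: chain_indices_def)
    next
      case complement
      then have "l \<in> chain_indices x n \<B>" using C(1) by (auto simp: chain_indices_def)
      then show ?thesis using complement by blast
    next
      case singleton
      then have "C = {p} \<or> C = {q}" using C(2) by auto
      then show ?thesis using True p q by blast
    qed
  next
    case False
    then show ?thesis
      using C(1) by (auto simp: singleton_generators_def chain_member_def)
  qed
  then show False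
    using chain_constant_on_block[OF _ p(1) q(1)] C(2) p(1) q(1) sub by blast
qed

lemma missing_singleton_exists:
  obtains t where "t \<in> block" "{t} \<notin> singleton_generators x n \<B>"
proof -
  have "\<exists>t\<in>block. {t} \<notin> singleton_generators x n \<B>"
  proof (rule ccontr)
    assume "\<not> ?thesis"
    then have all: "\<And>s. s \<in> block \<Longrightarrow> {s} \<in> singleton_generators x n \<B>" by blast
    have "x i' \<in> block" using less by (simp add: block_eq)
    then obtain t where t: "t \<in> block" by blast
    let ?F = "indicat_real ` (\<B> - {{t}})"
    have tB: "{t} \<in> \<B>" and tC: "{t} \<notin> chain_member x n \<B> ` chain_indices x n \<B>"
      using all[OF t] by (auto simp: singleton_generators_def)
    have "lower_set x i' = lower_set x i \<union> block"
      using less by (auto simp: block_def lower_set_def)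
    then have "indicat_real (lower_set x i') = indicat_real (lower_set x i) + indicat_real block"
      using indicat_real_Un_disjoint[of "lower_set x i" block] by (auto simp: block_def)
    moreover have "indicat_real block = indicat_real {t} + (\<Sum>s\<in>block - {t}. indicat_real {s})"
      using indicat_real_eq_sum_singletons[OF finite_block] sum.remove[OF finite_block t]
      by metis
    \<comment> \<open>Both expressions for the indicator of the block are equated and solved for the
      singleton \<open>{t}\<close>; every term on the right is spanned by the family without
      \<open>{t}\<close>.\<close>
    ultimately have "indicat_real {t} = indicat_real (lower_set x i')
        - indicat_real (lower_set x i) - (\<Sum>s\<in>block - {t}. indicat_real {s})"
      by (simp add: algebra_simps)
    moreover have "(\<Sum>s\<in>block - {t}. indicat_real {s}) \<in> span ?F"
      using all by (intro span_sum span_base imageI) (auto simp: singleton_generators_def)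
    ultimately have "indicat_real {t} \<in> span ?F"
      using lower_set_in_span[OF i tC] lower_set_in_span[OF i' tC] by (simp add: span_diff)
    \<comment> \<open>Dependence removes a vector from the image, whereas \<open>?F\<close> removes
      a set from the family; injectivity of the indicator map identifies the two.\<close>
    moreover have "?F = indicat_real ` \<B> - {indicat_real {t}}"
      using inj_indicat_real by (auto simp: inj_def)
    ultimately have "dependent (indicat_real ` \<B>)"
      unfolding dependent_def using tB by auto
    then show False using MESC by (simp add: is_MESC_def)
  qed
  with that show ?thesis by blast
qed

text \<open>Reduces the description of the singletons in a block to the position of one point
  \<open>t\<close>.\<close>

lemma singleton_generators_block:
  obtains t where "t \<in> block"
    "{C \<in> singleton_generators x n \<B>. \<exists>s\<in>block. C = {s}} = (\<lambda>s. {s}) ` (block - {t})"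
proof -
  obtain t where t: "t \<in> block" "{t} \<notin> singleton_generators x n \<B>"
    by (rule missing_singleton_exists)
  then have "\<And>s. s \<in> block \<Longrightarrow> s \<noteq> t \<longleftrightarrow> {s} \<in> singleton_generators x n \<B>"
    using missing_singleton_unique by blast
  with t that[of t] show ?thesis by blast
qed

text \<open>Otherwise maximality puts the next lower set into \<B>, which makes \<open>i + 1\<close>
  a chain index. The bound \<open>i + 1 < i'\<close> places it strictly between two consecutive
  ones.\<close>

lemma first_singleton_notin_family:
  assumes A: "lower_set x i \<in> \<B>" and "i + 1 < i'"
  shows "{x (i + 1)} \<notin> \<B>"
proof
  assume B: "{x (i + 1)} \<in> \<B>"
  have Un: "lower_set x i \<union> {x (i + 1)} = lower_set x (i + 1)"
    by (auto simp: lower_set_def atLeastAtMostSuc_conv)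
  have notin: "x (i + 1) \<notin> lower_set x i"
    using mem_lower_set[of "i + 1" i] bounds less by auto
  \<comment> \<open>The points \<open>x 1\<close> and \<open>x (i + 1)\<close> witness that neither
    set is the ground set: each lies in exactly one of the two sets.\<close>
  have ground: "x 1 \<in> ground x n" "x (i + 1) \<in> ground x n"
    using bounds less by (auto simp: ground_def)
  have first: "x 1 \<in> lower_set x i" using bounds by (auto simp: lower_set_def)
  have "x 1 \<notin> {x (i + 1)}" using first notin by auto
  then have ne: "{x (i + 1)} \<noteq> ground x n" using ground(1) by metis
  have "lower_set x i \<noteq> ground x n" using notin ground(2) by metis
  moreover have "lower_set x i \<noteq> {x (i + 1)}" using notin by blast
  moreover have "lower_set x i \<inter> {x (i + 1)} = {}" using notin by blast
  moreover have "lower_set x i \<union> {x (i + 1)} \<in> generators x n"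
    unfolding Un generators_def using bounds less by auto
  ultimately have "lower_set x i \<union> {x (i + 1)} \<in> \<B>"
    using Un_generator_in_family[OF A B] ne by blast
  then have "i + 1 \<in> chain_indices x n \<B>"
    unfolding Un using bounds less by (auto simp: chain_indices_def)
  then show False using consecutive[of "i + 1"] assms(2) by simp
qed

text \<open>Dual argument: adding \<open>x i'\<close> to the complement of the lower set at
  \<open>i'\<close> gives the complement of the one at \<open>i' - 1\<close>, so that
  \<open>i' - 1\<close> would be a chain index strictly between \<open>i\<close> and
  \<open>i'\<close>.\<close>

lemma last_singleton_notin_family:
  assumes A: "ground x n - lower_set x i' \<in> \<B>" and "i' < n" "i + 1 < i'"
  shows "{x i'} \<notin> \<B>"
proof
  assume B: "{x i'} \<in> \<B>"
  have "lower_set x i' = insert (x i') (lower_set x (i' - 1))"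
    using less by (cases i') (auto simp: lower_set_def atLeastAtMostSuc_conv)
  moreover have "x i' \<notin> lower_set x (i' - 1)"
    using mem_lower_set[of i' "i' - 1"] bounds less by auto
  moreover have last: "x i' \<in> lower_set x i'" using less by (auto simp: lower_set_def)
  moreover have ground: "x i' \<in> ground x n" "x n \<in> ground x n"
    using bounds less by (auto simp: ground_def)
  ultimately have Un: "(ground x n - lower_set x i') \<union> {x i'} = ground x n - lower_set x (i' - 1)"
    by blast
  \<comment> \<open>Here \<open>i' < n\<close> provides the point \<open>x n\<close> that shows
    \<open>{x i'}\<close> to differ from the ground set.\<close>
  have "x n \<notin> lower_set x i'"
    using mem_lower_set[of n i'] bounds less assms(2) by auto
  then have "x n \<notin> {x i'}" using last by auto
  then have "{x i'} \<noteq> ground x n" using ground(2) by metis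
  moreover have "ground x n - lower_set x i' \<noteq> ground x n" using last ground(1) by blast
  moreover have "ground x n - lower_set x i' \<noteq> {x i'}" using last by blast
  moreover have "(ground x n - lower_set x i') \<inter> {x i'} = {}" using last by blast
  moreover have "(ground x n - lower_set x i') \<union> {x i'} \<in> generators x n"
  proof -
    \<comment> \<open>Complements are generators only for indices from 1 to \<open>n - 1\<close>;
      the lower bound comes from \<open>1 \<le> i\<close> and \<open>i < i'\<close>.\<close>
    have "1 \<le> i' - 1" "i' - 1 \<le> n - 1" using bounds less by auto
    then show ?thesis unfolding Un generators_def by blast
  qed
  ultimately have "(ground x n - lower_set x i') \<union> {x i'} \<in> \<B>"
    using Un_generator_in_family[OF A B] by blast
  then have "i' - 1 \<in> chain_indices x n \<B>"
    unfolding Un using bounds less by (auto simp: chain_indices_def)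
  then show False using consecutive[of "i' - 1"] assms(3) by linarith
qed

end

section \<open>Ends of increasing enumerations and the four cases\<close>

lemma sorted_enumerations_agree_at_ends:
  fixes x y :: "nat \<Rightarrow> 'a :: linorder"
  assumes "strict_mono_on {a..b} x" "strict_mono_on {c..d} y" "x ` {a..b} = y ` {c..d}" "a \<le> b"
  shows "y c = x a" and "y d = x b"
proof -
  have "c \<le> d"
  proof (rule ccontr)
    assume "\<not> c \<le> d"
    then show False using assms(3,4) by simp
  qed
  show "y c = x a"
  proof (rule antisym)
    obtain l where "l \<in> {c..d}" "x a = y l" using assms(3,4)
      by (metis atLeastAtMost_iff imageE imageI order_refl)
    then show "y c \<le> x a" using strict_mono_on_leD[OF assms(2), of c l] by auto
    obtain l where "l \<in> {a..b}" "y c = x l" using assms(3) \<open>c \<le> d\<close>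
      by (metis atLeastAtMost_iff imageE imageI order_refl)
    then show "x a \<le> y c" using strict_mono_on_leD[OF assms(1), of a l] by auto
  qed
  show "y d = x b"
  proof (rule antisym)
    obtain l where "l \<in> {a..b}" "y d = x l" using assms(3) \<open>c \<le> d\<close>
      by (metis atLeastAtMost_iff imageE imageI order_refl)
    then show "y d \<le> x b" using strict_mono_on_leD[OF assms(1), of l b] by auto
    obtain l where "l \<in> {c..d}" "x b = y l" using assms(3,4)
      by (metis atLeastAtMost_iff imageE imageI order_refl)
    then show "x b \<le> y d" using strict_mono_on_leD[OF assms(2), of l d] by auto
  qed
qed

theorem mainTheorem2:
  fixes x :: "nat \<Rightarrow> real" and n :: nat and \<B> :: "real set set"
    and k :: nat and idx :: "nat \<Rightarrow> nat" and j :: nat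
    and A A' :: "real set" and m :: nat and y :: "nat \<Rightarrow> real"
    and \<S> :: "real set set"
  assumes x_mono: "strict_mono_on {1..n} x"
    and B_gen: "\<B> \<subseteq> generators x n"
    and mesc: "is_MESC x n \<B>"
    and idx_mono: "strict_mono_on {1..k} idx"
    and idx_chain: "idx ` {1..k} = chain_indices x n \<B>"
    and j_range: "1 \<le> j" "j \<le> k - 1"
    and A_eq: "A = lower_set x (idx j)"
    and A'_eq: "A' = lower_set x (idx (j + 1))"
    and m_eq: "m = card (A' - A)"
    and y_mono: "strict_mono_on {1..m} y"
    and y_image: "y ` {1..m} = A' - A"
    and S_eq: "\<S> = {C \<in> singleton_generators x n \<B>. \<exists>t \<in> A' - A. C = {t}}"
  shows
    "(chain_member x n \<B> (idx j) = A \<and> chain_member x n \<B> (idx (j + 1)) = A'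
        \<longrightarrow> \<S> = (\<lambda>l. {y l}) ` {2..m})
     \<and> (chain_member x n \<B> (idx j) = A \<and> chain_member x n \<B> (idx (j + 1)) = ground x n - A'
        \<longrightarrow> m = 1 \<and> \<S> = {})
     \<and> (chain_member x n \<B> (idx j) = ground x n - A \<and> chain_member x n \<B> (idx (j + 1)) = A'
        \<longrightarrow> \<S> \<subseteq> (\<lambda>l. {y l}) ` {1..m} \<and> card \<S> = m - 1)
     \<and> (chain_member x n \<B> (idx j) = ground x n - A
            \<and> chain_member x n \<B> (idx (j + 1)) = ground x n - A'
        \<longrightarrow> \<S> = (\<lambda>l. {y l}) ` {1..m - 1})"
proof -
  interpret MESC x n \<B>
    using x_mono B_gen mesc by unfold_locales
  define i i' where i_def: "i = idx j" and i'_def: "i' = idx (j + 1)"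
  have range: "j \<in> {1..k}" "j + 1 \<in> {1..k}" using j_range by auto
  interpret MESC_block x n \<B> i i'
  proof
    show "i \<in> chain_indices x n \<B>" "i' \<in> chain_indices x n \<B>"
      unfolding i_def i'_def using range unfolding idx_chain[symmetric] by blast+
    show "i < i'" using strict_mono_onD[OF idx_mono range] by (simp add: i_def i'_def)
    fix l assume l: "i < l" "l < i'"
    show "l \<notin> chain_indices x n \<B>"
    proof
      assume "l \<in> chain_indices x n \<B>"
      then obtain b where b: "b \<in> {1..k}" "l = idx b" unfolding idx_chain[symmetric] by blast
      \<comment> \<open>No position lies strictly between \<open>j\<close> and \<open>j + 1\<close>,
        so by monotonicity of \<open>idx\<close> no chain index lies strictly between
        \<open>i\<close> and \<open>i'\<close>.\<close>
      have "b \<le> j \<or> j + 1 \<le> b" by linarith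
      then show False
        using strict_mono_on_leD[OF idx_mono b(1) range(1)]
          strict_mono_on_leD[OF idx_mono range(2) b(1)] l b(2)
        by (auto simp: i_def i'_def)
    qed
  qed
  have A: "A = lower_set x i" and A': "A' = lower_set x i'"
    by (simp_all add: A_eq A'_eq i_def i'_def)
  have D: "A' - A = block" by (simp add: block_def A A')
  have inj_y: "inj_on y {1..m}" using y_mono by (rule strict_mono_on_imp_inj_on)
  have inj_block: "inj_on x {i + 1..i'}"
    using inj by (rule inj_on_subset) (use bounds in auto)
  have m: "m = i' - i"
    unfolding m_eq D block_eq card_image[OF inj_block] by simp
  have mono_block: "strict_mono_on {i + 1..i'} x"
    using x_mono by (rule monotone_on_subset) (use bounds in auto)
  \<comment> \<open>\<open>y\<close> is given only as some increasing enumeration of the block;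
    matching its ends with those of \<open>x\<close> makes the two exclusion lemmas
    applicable.\<close>
  have y_ends: "y 1 = x (i + 1)" "y m = x i'"
    using sorted_enumerations_agree_at_ends[OF mono_block y_mono] y_image D block_eq less by auto
  obtain t where t: "t \<in> block" and S: "\<S> = (\<lambda>s. {s}) ` (block - {t})"
    unfolding S_eq D by (rule singleton_generators_block)
  have in_B: "{s} \<in> \<B>" if "s \<in> block" "s \<noteq> t" for s
  proof -
    have "{s} \<in> \<S>" using that S by blast
    then show ?thesis by (simp add: S_eq singleton_generators_def)
  qed
  have ends: "y 1 \<in> block" "y m \<in> block"
    using less unfolding y_ends by (auto simp: block_eq)
  have y_block: "y ` {1..m} = block" using y_image D by simp
  have first: "t = y 1" if "lower_set x i \<in> \<B>" "1 < m"
  proof (rule ccontr)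
    assume "t \<noteq> y 1"
    then have "{x (i + 1)} \<in> \<B>" using in_B[OF ends(1)] y_ends(1) by simp
    then show False using first_singleton_notin_family[OF that(1)] that(2) m by linarith
  qed
  have last: "t = y m" if "chain_member x n \<B> i' = ground x n - A'" "1 < m"
  proof (rule ccontr)
    assume "t \<noteq> y m"
    then have "{x i'} \<in> \<B>" using in_B[OF ends(2)] y_ends(2) by simp
    then show False
      using last_singleton_notin_family[OF chain_member_eq_complementD[OF i' that(1)[unfolded A']]]
        that(2) m by linarith
  qed
  have lower: "lower_set x i \<in> \<B>" if "chain_member x n \<B> i = A"
    using chain_member_eq_lower_setD[OF i] that by (simp add: A)
  have "m \<ge> 1" using m less by simp
  \<comment> \<open>A block with one point leaves no choice for \<open>t\<close>. Maximality says
    nothing here, since enlarging by that point produces the neighbouring chain set or its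
    complement.\<close>
  have singleton: "t = y 1" "t = y m" if "m = 1"
    using t y_block that by auto
  have minus: "\<S> = (\<lambda>l. {y l}) ` ({1..m} - {a})" if "t = y a" "a \<in> {1..m}" for a
  proof -
    have "block - {t} = y ` ({1..m} - {a})"
      using inj_on_image_set_diff[OF inj_y, of "{1..m}" "{a}"] that y_block by auto
    then show ?thesis by (simp add: S image_image)
  qed
  have case1: "\<S> = (\<lambda>l. {y l}) ` {2..m}" if "chain_member x n \<B> i = A"
  proof -
    have "t = y 1" using first[OF lower[OF that]] singleton \<open>m \<ge> 1\<close> by linarith
    moreover have "{1..m} - {1} = {2..m}" by auto
    ultimately show ?thesis using minus[of 1] \<open>m \<ge> 1\<close> by simp
  qed
  have case2: "m = 1 \<and> \<S> = {}"
    if "chain_member x n \<B> i = A" "chain_member x n \<B> i' = ground x n - A'"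
  proof -
    have "m = 1"
    \<comment> \<open>In a longer block the one missing point would have to be both the first and
      the last, against injectivity of \<open>y\<close>.\<close>
    proof (rule ccontr)
      assume "m \<noteq> 1"
      then have "1 < m" using \<open>m \<ge> 1\<close> by simp
      then have "y 1 = y m" using first[OF lower[OF that(1)]] last[OF that(2)] by simp
      then show False using inj_onD[OF inj_y, of 1 m] \<open>1 < m\<close> by simp
    qed
    then show ?thesis using case1[OF that(1)] by simp
  qed
  have case3: "\<S> \<subseteq> (\<lambda>l. {y l}) ` {1..m}" "card \<S> = m - 1"
  proof -
    show "\<S> \<subseteq> (\<lambda>l. {y l}) ` {1..m}"
      unfolding S y_block[symmetric] by auto
    have "card \<S> = card (block - {t})" unfolding S by (rule card_image) simp
    then show "card \<S> = m - 1" using t finite_block by (simp add: m_eq D)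
  qed
  have case4: "\<S> = (\<lambda>l. {y l}) ` {1..m - 1}"
    if "chain_member x n \<B> i' = ground x n - A'"
  proof -
    have "t = y m" using last[OF that] singleton \<open>m \<ge> 1\<close> by linarith
    moreover have "{1..m} - {m} = {1..m - 1}" by auto
    ultimately show ?thesis using minus[of m] \<open>m \<ge> 1\<close> by simp
  qed
  show ?thesis
    unfolding i_def[symmetric] i'_def[symmetric] using case1 case2 case3 case4 by blast
qed

end
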